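(* Let $\mathbb K$ be $\mathbb H$ or $\mathbb O$, let $n\in\mathbb N$ with $n>1$, and let $f:\mathbb R\times\mathbb S(-\pi n,\pi n)\to\mathbb K\times\mathbb K\cong\mathbb R^{2\dim\mathbb K}$ be defined by $$f(x+Iy)=\left(\sinh x\cos y+I\sinh x\sin y,\ n\exp\left(I\frac yn\right)\right)$$ for $I\in\mathbb S$, $x\in\mathbb R$, $y\in(-\pi n,\pi n)$. Then $f(\mathbb R\times\mathbb S(-\pi n,\pi n))$ is a parameterized hypercomplex Riemann manifold (diffeomorphic to $\mathbb R\times\mathbb S(-\pi n,\pi n)$) and $f$ is a slice isothermal parameterization.
   Context: $\mathbb K$ is the division algebra of quaternions $\mathbb H$ or octonions $\mathbb O$, identified with $\mathbb R^{\dim\mathbb K}$ ($\dim\mathbb K=4$ or $8$) with the Euclidean scalar product. $\mathbb S=\{I\in\mathbb K: I^2=-1\}$. $\mathbb R\times\mathbb S(-\pi n,\pi n)$ denotes $\{x+Iy: x\in\mathbb R,\ y\in(-\pi n,\pi n),\ I\in\mathbb S\}\subset\mathbb K$. For $I\in\mathbb S$, $\mathbb C_I=\mathbb R+I\mathbb R$ and $\mathbb C_I^\perp$ is its orthogonal complement in $\mathbb K$. $\exp(It)=\cos t+I\sin t$. A linear map $T$ from a $d$-dimensional Euclidean space to $\mathbb R^N$ is conformal if $T^tT=k\,\mathrm{Id}$ with $k\ne0$. A slice domain $\Omega\subseteq\mathbb K$ is an open connected set containing real points such that $\Omega\cap\mathbb C_I$ is a domain of $\mathbb C_I$ for each $I\in\mathbb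 S$. A $C^1$ map $f:\Omega\to\mathbb R^N$ ($N\ge\dim\mathbb K$) is slice conformal (slice isothermal) if for all $I\in\mathbb S$ and all $x+Iy\in\Omega$ both $df(x+Iy)_{|\mathbb C_I}$ and $df(x+Iy)_{|\mathbb C_I^\perp}$ are conformal. If $f$ is in addition an injective immersion, $f$ is a slice conformal (slice isothermal) parameterization and $f(\Omega)$ is a parameterized hypercomplex Riemann manifold of $\mathbb R^N$. *)

theory Defs
  imports "HOL-Analysis.Analysis"
begin

section \<open>Quaternions and octonions by Cayley--Dickson doubling\<close>

class cayley_dickson = euclidean_space + one + times +
  fixes conjugate :: "'a \<Rightarrow> 'a"

instantiation complex :: cayley_dickson
begin

definition conjugate_complex :: "complex \<Rightarrow> complex"
  where "conjugate_complex = cnj"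

instance ..

end

datatype 'a double = Double (left_part: 'a) (right_part: 'a)

instantiation double :: (real_vector) real_vector
begin

definition zero_double :: "'a double"
  where "0 = Double 0 0"

definition plus_double :: "'a double \<Rightarrow> 'a double \<Rightarrow> 'a double"
  where "p + q = Double (left_part p + left_part q) (right_part p + right_part q)"

definition uminus_double :: "'a double \<Rightarrow> 'a double"
  where "- p = Double (- left_part p) (- right_part p)"

definition minus_double :: "'a double \<Rightarrow> 'a double \<Rightarrow> 'a double"
  where "p - q = Double (left_part p - left_part q) (right_part p - right_part q)"

definition scaleR_double :: "real \<Rightarrow> 'a double \<Rightarrow> 'a double"
  where "r *\<^sub>R p = Double (r *\<^sub>R left_part p) (r *\<^sub>R right_part p)"

instance
  by standard
    (simp_all add: zero_double_def plus_double_def uminus_double_def minus_double_def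
      scaleR_double_def scaleR_add_left scaleR_add_right)

end

instantiation double :: (real_normed_vector) real_normed_vector
begin

definition norm_double :: "'a double \<Rightarrow> real"
  where "norm p = sqrt ((norm (left_part p))\<^sup>2 + (norm (right_part p))\<^sup>2)"

definition sgn_double :: "'a double \<Rightarrow> 'a double"
  where "sgn (p :: 'a double) = p /\<^sub>R norm p"

definition dist_double :: "'a double \<Rightarrow> 'a double \<Rightarrow> real"
  where "dist (p :: 'a double) q = norm (p - q)"

definition uniformity_double :: "('a double \<times> 'a double) filter"
  where "uniformity = (INF e\<in>{0 <..}. principal {(p :: 'a double, q). dist p q < e})"

definition open_double :: "'a double set \<Rightarrow> bool"
  where "open (U :: 'a double set) \<longleftrightarrow> (\<forall>p\<in>U. eventually (\<lambda>(p', q). p' = p \<longrightarrow> q \<in> U) uniformity)"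

instance
proof
  fix p q :: "'a double" and c :: real
  show "norm p = 0 \<longleftrightarrow> p = 0"
    by (cases p) (simp add: norm_double_def zero_double_def)
  show "norm (p + q) \<le> norm p + norm q"
    using norm_triangle_ineq [of "(left_part p, right_part p)" "(left_part q, right_part q)"]
    by (simp add: norm_double_def plus_double_def norm_Pair)
  show "norm (c *\<^sub>R p) = \<bar>c\<bar> * norm p"
    using norm_scaleR [of c "(left_part p, right_part p)"]
    by (simp add: norm_double_def scaleR_double_def norm_Pair)
qed (simp_all only: sgn_double_def dist_double_def uniformity_double_def open_double_def)

end

instantiation double :: (real_inner) real_inner
begin

definition inner_double :: "'a double \<Rightarrow> 'a double \<Rightarrow> real"
  where "p \<bullet> q = left_part p \<bullet> left_part q + right_part p \<bullet> right_part q"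

instance
proof
  fix p q r :: "'a double" and c :: real
  show "p \<bullet> q = q \<bullet> p"
    by (simp add: inner_double_def inner_commute)
  show "(p + q) \<bullet> r = p \<bullet> r + q \<bullet> r"
    by (simp add: inner_double_def plus_double_def inner_add_left)
  show "(c *\<^sub>R p) \<bullet> q = c * (p \<bullet> q)"
    by (simp add: inner_double_def scaleR_double_def algebra_simps)
  show "0 \<le> p \<bullet> p"
    by (simp add: inner_double_def)
  show "p \<bullet> p = 0 \<longleftrightarrow> p = 0"
    by (cases p) (simp add: inner_double_def zero_double_def add_nonneg_eq_0_iff)
  show "norm p = sqrt (p \<bullet> p)"
    by (simp add: norm_double_def inner_double_def power2_norm_eq_inner)
qed

end

instantiation double :: (euclidean_space) euclidean_space
begin

definition Basis_double :: "'a double set"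
  where "Basis = (\<lambda>b. Double b 0) ` Basis \<union> (\<lambda>b. Double 0 b) ` Basis"

instance
proof
  fix p q :: "'a double"
  show "p \<in> Basis \<Longrightarrow> q \<in> Basis \<Longrightarrow> p \<bullet> q = (if p = q then 1 else 0)"
    by (auto simp: Basis_double_def inner_double_def inner_Basis split: if_split_asm)
  show "(\<forall>b\<in>Basis. p \<bullet> b = 0) \<longleftrightarrow> p = 0"
    by (cases p)
      (simp add: Basis_double_def inner_double_def zero_double_def ball_Un euclidean_all_zero_iff)
qed (simp_all add: Basis_double_def)

end

lemma DIM_double [simp]: "DIM('a::euclidean_space double) = 2 * DIM('a)"
  unfolding Basis_double_def
  by (subst card_Un_disjoint) (auto simp: card_image inj_on_def)

instantiation double :: (cayley_dickson) cayley_dickson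
begin

definition one_double :: "'a double"
  where "1 = Double 1 0"

definition times_double :: "'a double \<Rightarrow> 'a double \<Rightarrow> 'a double"
  where "p * q = Double
    (left_part p * left_part q - conjugate (right_part q) * right_part p)
    (right_part q * left_part p + right_part p * conjugate (left_part q))"

definition conjugate_double :: "'a double \<Rightarrow> 'a double"
  where "conjugate p = Double (conjugate (left_part p)) (- right_part p)"

instance ..

end

type_synonym quaternion = "complex double"
type_synonym octonion = "quaternion double"


section \<open>Slices\<close>

definition imaginary_units :: "'a::cayley_dickson set"
  where "imaginary_units = {I. I * I = - 1}"

definition slice_plane :: "'a::cayley_dickson \<Rightarrow> 'a set"
  where "slice_plane I = {x *\<^sub>R 1 + y *\<^sub>R I | x y. True}"

text \<open>The set \<open>\<real> \<times> \<S>(-a, a)\<close>.\<close>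

definition slice_strip :: "real \<Rightarrow> 'a::cayley_dickson set"
  where "slice_strip a =
    {x *\<^sub>R 1 + y *\<^sub>R I | x y I. I \<in> imaginary_units \<and> - a < y \<and> y < a}"

definition slice_domain :: "'a::cayley_dickson set \<Rightarrow> bool"
  where "slice_domain \<Omega> \<longleftrightarrow>
    open \<Omega> \<and> connected \<Omega> \<and> (\<exists>x::real. x *\<^sub>R 1 \<in> \<Omega>) \<and>
    (\<forall>I\<in>imaginary_units. \<Omega> \<inter> slice_plane I \<noteq> {} \<and>
      openin (top_of_set (slice_plane I)) (\<Omega> \<inter> slice_plane I) \<and>
      connected (\<Omega> \<inter> slice_plane I))"


section \<open>Differentiability classes and diffeomorphisms\<close>

text \<open>Class \<open>C\<^sup>k\<close> on an open set, by means of iterated directional derivatives.\<close>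

fun differentiable_class_on ::
    "nat \<Rightarrow> 'a::euclidean_space set \<Rightarrow> ('a \<Rightarrow> 'b::euclidean_space) \<Rightarrow> bool"
  where
    "differentiable_class_on 0 S f \<longleftrightarrow> continuous_on S f"
  | "differentiable_class_on (Suc k) S f \<longleftrightarrow>
      (\<forall>p\<in>S. f differentiable (at p)) \<and>
      (\<forall>v. differentiable_class_on k S (\<lambda>p. frechet_derivative f (at p) v))"

text \<open>Smoothness on an arbitrary subset means local extendability to a smooth map on an open
  set of the ambient space.\<close>

definition smooth_map_on :: "'a::euclidean_space set \<Rightarrow> ('a \<Rightarrow> 'b::euclidean_space) \<Rightarrow> bool"
  where "smooth_map_on X f \<longleftrightarrow>
    (\<forall>p\<in>X. \<exists>U g. open U \<and> p \<in> U \<and> (\<forall>k. differentiable_class_on k U g) \<and>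
      (\<forall>q\<in>X \<inter> U. g q = f q))"

definition diffeomorphic :: "'a::euclidean_space set \<Rightarrow> 'b::euclidean_space set \<Rightarrow> bool"
  where "diffeomorphic X Y \<longleftrightarrow>
    (\<exists>\<phi> \<psi>. homeomorphism X Y \<phi> \<psi> \<and> smooth_map_on X \<phi> \<and> smooth_map_on Y \<psi>)"


section \<open>Slice conformal maps\<close>

text \<open>Conformality of the restriction of \<open>T\<close> to the Euclidean space \<open>V\<close>; here \<open>T'\<close> is the
  transpose of this restriction, a map into \<open>V\<close>.\<close>

definition conformal_on :: "'a::euclidean_space set \<Rightarrow> ('a \<Rightarrow> 'b::euclidean_space) \<Rightarrow> bool"
  where "conformal_on V T \<longleftrightarrow> linear T \<and>
    (\<exists>T' k. (\<forall>w. T' w \<in> V) \<and> (\<forall>v\<in>V. \<forall>w. T v \<bullet> w = v \<bullet> T' w) \<and>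
      k \<noteq> (0::real) \<and> (\<forall>v\<in>V. T' (T v) = k *\<^sub>R v))"

definition slice_isothermal ::
    "'a::cayley_dickson set \<Rightarrow> ('a \<Rightarrow> 'b::euclidean_space) \<Rightarrow> bool"
  where "slice_isothermal \<Omega> f \<longleftrightarrow>
    DIM('a) \<le> DIM('b) \<and> slice_domain \<Omega> \<and> differentiable_class_on 1 \<Omega> f \<and>
    (\<forall>I\<in>imaginary_units. \<forall>x y. x *\<^sub>R 1 + y *\<^sub>R I \<in> \<Omega> \<longrightarrow>
      conformal_on (slice_plane I) (frechet_derivative f (at (x *\<^sub>R 1 + y *\<^sub>R I))) \<and>
      conformal_on ((slice_plane I)\<^sup>\<bottom>) (frechet_derivative f (at (x *\<^sub>R 1 + y *\<^sub>R I))))"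

definition slice_isothermal_parameterization ::
    "'a::cayley_dickson set \<Rightarrow> ('a \<Rightarrow> 'b::euclidean_space) \<Rightarrow> bool"
  where "slice_isothermal_parameterization \<Omega> f \<longleftrightarrow>
    slice_isothermal \<Omega> f \<and> inj_on f \<Omega> \<and> (\<forall>p\<in>\<Omega>. inj (frechet_derivative f (at p)))"

definition parameterized_hypercomplex_riemann_manifold ::
    "'a::cayley_dickson itself \<Rightarrow> 'b::euclidean_space set \<Rightarrow> bool"
  where "parameterized_hypercomplex_riemann_manifold _ M \<longleftrightarrow>
    (\<exists>(\<Omega> :: 'a set) f. slice_isothermal_parameterization \<Omega> f \<and> M = f ` \<Omega>)"


section \<open>The map\<close>

definition exp_slice :: "'a::cayley_dickson \<Rightarrow> real \<Rightarrow> 'a"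
  where "exp_slice I t = cos t *\<^sub>R 1 + sin t *\<^sub>R I"

text \<open>A point has several representations \<open>x + I y\<close>, so this predicate is satisfiable only
  because the formula does not depend on the choice; it determines \<open>f\<close> only on
  \<open>slice_strip (pi * n)\<close>.\<close>

definition strip_map_formula :: "nat \<Rightarrow> ('a::cayley_dickson \<Rightarrow> 'a \<times> 'a) \<Rightarrow> bool"
  where "strip_map_formula n f \<longleftrightarrow>
    (\<forall>I\<in>imaginary_units. \<forall>x y. - (pi * real n) < y \<and> y < pi * real n \<longrightarrow>
      f (x *\<^sub>R 1 + y *\<^sub>R I) =
        ((sinh x * cos y) *\<^sub>R 1 + (sinh x * sin y) *\<^sub>R I,
         real n *\<^sub>R exp_slice I (y / real n)))"

end

theory Submission
  imports Defs
begin

text \<open>Write a point as \<open>p = x + v\<close> with \<open>x\<close> real and \<open>v = I y\<close> imaginary. Since \<open>cos y\<close> and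
  \<open>sin y / y\<close> are entire functions of \<open>y\<^sup>2 = v \<bullet> v\<close>, the map is the restriction of the smooth map
  \<open>p \<mapsto> (sinh x exp v, n exp (v / n))\<close>. Its differential sends \<open>1\<close> and \<open>I\<close> to orthogonal vectors of
  squared length \<open>cosh\<^sup>2 x\<close>, and any \<open>h\<close> orthogonal to both to
  \<open>(sinh x (sin y / y) h, (sin (y / n) / (y / n)) h)\<close>, whose second component does not vanish for
  \<open>\<bar>y\<bar> < \<pi> n\<close>. The inverse is smooth as well: \<open>v\<close> is recovered from \<open>b = n exp (v / n)\<close> through
  the half angle, \<open>I tan (y / 2n) = Im b / (n + Re b)\<close>, which has no singularity at \<open>v = 0\<close>,
  and \<open>sinh x\<close> is the scalar product of the first component with the unit vector \<open>exp v\<close>.\<close>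

section \<open>Closure properties of the classes \<open>C\<^sup>k\<close>\<close>

text \<open>Openness turns agreement on \<open>S\<close> into agreement near each point of
  \<open>S\<close>, so the derivatives agree on \<open>S\<close> too and the induction continues
  with them.\<close>

lemma differentiable_class_on_cong:
  assumes "open S" "\<And>p. p \<in> S \<Longrightarrow> f p = g p" "differentiable_class_on k S f"
  shows "differentiable_class_on k S g"
  using assms(2,3)
proof (induction k arbitrary: f g)
  case 0
  then show ?case by (simp cong: continuous_on_cong)
next
  case (Suc k)
  have D: "(g has_derivative frechet_derivative f (at p)) (at p)" if "p \<in> S" for p
    using Suc.prems that \<open>open S\<close>
    by (intro has_derivative_transform_within_open[of f _ p UNIV S g])
      (simp_all add: frechet_derivative_works[symmetric])
  have eq: "frechet_derivative f (at p) v = frechet_derivative g (at p) v" if "p \<in> S" for p v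
    using frechet_derivative_at[OF D[OF that]] by simp
  have "differentiable_class_on k S (\<lambda>p. frechet_derivative g (at p) v)" for v
  proof (rule Suc.IH)
    show "differentiable_class_on k S (\<lambda>p. frechet_derivative f (at p) v)"
      using Suc.prems(2) by simp
  qed (rule eq)
  then show ?case
    using D by (auto simp: differentiable_def)
qed

text \<open>Derivatives at a point are unique, so any explicit derivative \<open>D\<close> may
  replace \<open>frechet_derivative\<close>; later proofs work only with explicit formulas.\<close>

lemma differentiable_class_on_SucI:
  assumes "open S" and D: "\<And>p. p \<in> S \<Longrightarrow> (f has_derivative D p) (at p)"
    and "\<And>v. differentiable_class_on k S (\<lambda>p. D p v)"
  shows "differentiable_class_on (Suc k) S f"
proof -
  have "differentiable_class_on k S (\<lambda>p. frechet_derivative f (at p) v)" for v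
    by (rule differentiable_class_on_cong[OF \<open>open S\<close> _ assms(3)[of v]])
      (simp add: frechet_derivative_at[OF D, symmetric])
  then show ?thesis
    using D by (auto simp: differentiable_def)
qed

text \<open>The product and chain rules contain the undifferentiated functions again; their class
  has to be lowered by one before an induction hypothesis applies to them.\<close>

lemma differentiable_class_on_SucD:
  "differentiable_class_on (Suc k) S f \<Longrightarrow> differentiable_class_on k S f"
proof (induction k arbitrary: f)
  case 0
  then have "f differentiable_on S"
    by (simp add: differentiable_at_imp_differentiable_on)
  then show ?case
    by (simp add: differentiable_imp_continuous_on)
next
  case (Suc k)
  note prems = Suc.prems[unfolded differentiable_class_on.simps(2)[of "Suc k"]]
  show ?case
    unfolding differentiable_class_on.simps(2)[of k]
    using prems by (blast intro: Suc.IH)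
qed

lemma differentiable_class_on_subset:
  "differentiable_class_on k S f \<Longrightarrow> T \<subseteq> S \<Longrightarrow> differentiable_class_on k T f"
  by (induction k arbitrary: f) (auto intro: continuous_on_subset)

text \<open>Glues two local descriptions of one function, as is needed for
  \<open>arctanc_even\<close>, which is defined by cases.\<close>

lemma differentiable_class_on_Un:
  assumes "open S" "open T" "differentiable_class_on k S f" "differentiable_class_on k T f"
  shows "differentiable_class_on k (S \<union> T) f"
  using assms(3,4)
  by (induction k arbitrary: f) (use assms(1,2) in \<open>auto intro: continuous_on_open_Un\<close>)

lemma differentiable_class_on_imp_continuous_on:
  "differentiable_class_on k S f \<Longrightarrow> continuous_on S f"
  by (induction k) (auto dest: differentiable_class_on_SucD simp del: differentiable_class_on.simps(2))

lemma differentiable_class_on_const: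
  assumes "open S"
  shows "differentiable_class_on k S (\<lambda>p. c)"
proof (induction k arbitrary: c)
  case (Suc k)
  show ?case by (rule differentiable_class_on_SucI[OF assms]) (rule has_derivative_const, rule Suc)
qed simp

lemma differentiable_class_on_ident:
  assumes "open S"
  shows "differentiable_class_on k S (\<lambda>p. p)"
proof (cases k)
  case (Suc m)
  show ?thesis
    unfolding Suc
    by (rule differentiable_class_on_SucI[OF assms])
      (rule has_derivative_ident, rule differentiable_class_on_const[OF assms])
qed simp

lemma differentiable_class_on_linear:
  assumes "open S" "bounded_linear h" "differentiable_class_on k S f"
  shows "differentiable_class_on k S (\<lambda>p. h (f p))"
  using assms(3)
proof (induction k arbitrary: f)
  case 0
  then show ?case using assms(2) by (simp add: bounded_linear.continuous_on)
next
  case (Suc k)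
  show ?case
  proof (rule differentiable_class_on_SucI[OF assms(1)])
    show "((\<lambda>p. h (f p)) has_derivative (\<lambda>v. h (frechet_derivative f (at p) v))) (at p)"
      if "p \<in> S" for p
      using Suc.prems that
      by (intro bounded_linear.has_derivative[OF assms(2)]) (simp add: frechet_derivative_works[symmetric])
  qed (use Suc in auto)
qed

lemma differentiable_class_on_add:
  assumes "open S" "differentiable_class_on k S f" "differentiable_class_on k S g"
  shows "differentiable_class_on k S (\<lambda>p. f p + g p)"
  using assms(2,3)
proof (induction k arbitrary: f g)
  case (Suc k)
  show ?case
  proof (rule differentiable_class_on_SucI[OF assms(1)])
    show "((\<lambda>p. f p + g p) has_derivative
        (\<lambda>v. frechet_derivative f (at p) v + frechet_derivative g (at p) v)) (at p)"
      if "p \<in> S" for p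
      using Suc.prems that by (intro has_derivative_add) (simp_all add: frechet_derivative_works[symmetric])
  qed (use Suc in auto)
qed (simp add: continuous_on_add)

lemma differentiable_class_on_bilinear:
  assumes "open S" "bounded_bilinear h"
    and "differentiable_class_on k S f" "differentiable_class_on k S g"
  shows "differentiable_class_on k S (\<lambda>p. h (f p) (g p))"
  using assms(3,4)
proof (induction k arbitrary: f g)
  case 0
  then show ?case using assms(2) by (simp add: bounded_bilinear.continuous_on)
next
  case (Suc k)
  show ?case
  proof (rule differentiable_class_on_SucI[OF assms(1)])
    show "((\<lambda>p. h (f p) (g p)) has_derivative
        (\<lambda>v. h (f p) (frechet_derivative g (at p) v) + h (frechet_derivative f (at p) v) (g p))) (at p)"
      if "p \<in> S" for p
      using Suc.prems that
      by (intro bounded_bilinear.FDERIV[OF assms(2)]) (simp_all add: frechet_derivative_works[symmetric])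
    show "differentiable_class_on k S
        (\<lambda>p. h (f p) (frechet_derivative g (at p) v) + h (frechet_derivative f (at p) v) (g p))" for v
      using Suc.prems Suc.prems[THEN differentiable_class_on_SucD]
      by (intro differentiable_class_on_add[OF assms(1)] Suc.IH) simp_all
  qed
qed

lemmas differentiable_class_on_scaleR =
  differentiable_class_on_bilinear[OF _ bounded_bilinear_scaleR]
lemmas differentiable_class_on_mult =
  differentiable_class_on_bilinear[OF _ bounded_bilinear_mult[where 'a = real]]
lemmas differentiable_class_on_inner =
  differentiable_class_on_bilinear[OF _ bounded_bilinear_inner]

lemma differentiable_class_on_Pair:
  fixes f :: "'a::euclidean_space \<Rightarrow> 'b::euclidean_space" and g :: "'a \<Rightarrow> 'c::euclidean_space"
  assumes "open S" "differentiable_class_on k S f" "differentiable_class_on k S g"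
  shows "differentiable_class_on k S (\<lambda>p. (f p, g p))"
proof -
  have "bounded_linear (\<lambda>a::'b. (a, 0::'c))" "bounded_linear (\<lambda>b::'c. (0::'b, b))"
    by (intro bounded_linear_Pair bounded_linear_ident bounded_linear_zero)+
  from differentiable_class_on_add[OF assms(1) differentiable_class_on_linear[OF assms(1) this(1) assms(2)]
      differentiable_class_on_linear[OF assms(1) this(2) assms(3)]]
  show ?thesis by simp
qed

text \<open>With a real variable in between, the chain rule multiplies the derivative of
  \<open>f\<close> by \<open>h' (f p)\<close>, again a composition with the same \<open>f\<close>.
  Hence the induction varies only \<open>h\<close>.\<close>

lemma differentiable_class_on_compose:
  fixes h :: "real \<Rightarrow> real"
  assumes "open S" and "f ` S \<subseteq> T"
    and "differentiable_class_on k T h" "differentiable_class_on k S f"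
  shows "differentiable_class_on k S (\<lambda>p. h (f p))"
  using assms(3,4)
proof (induction k arbitrary: h)
  case 0
  then show ?case using assms(2) by (auto intro: continuous_on_compose2)
next
  case (Suc k)
  define h' where "h' t = frechet_derivative h (at t) 1" for t
  show ?case
  proof (rule differentiable_class_on_SucI[OF assms(1)])
    show "((\<lambda>p. h (f p)) has_derivative (\<lambda>v. frechet_derivative f (at p) v *\<^sub>R h' (f p))) (at p)"
      if "p \<in> S" for p
    proof -
      have f: "(f has_derivative frechet_derivative f (at p)) (at p)"
        using Suc.prems that by (simp add: frechet_derivative_works[symmetric])
      have h: "(h has_derivative frechet_derivative h (at (f p))) (at (f p))"
        using Suc.prems that assms(2) by (auto simp: frechet_derivative_works[symmetric])
      have "frechet_derivative h (at (f p)) t = t *\<^sub>R h' (f p)" for t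
        using linear.scaleR[OF has_derivative_linear[OF h], of t 1] by (simp add: h'_def)
      with has_derivative_compose[OF f h] show ?thesis by simp
    qed
    show "differentiable_class_on k S (\<lambda>p. frechet_derivative f (at p) v *\<^sub>R h' (f p))" for v
    proof (rule differentiable_class_on_scaleR[OF assms(1)])
      show "differentiable_class_on k S (\<lambda>p. h' (f p))"
        by (rule Suc.IH[OF _ differentiable_class_on_SucD[OF Suc.prems(2)]])
          (use Suc.prems(1) in \<open>simp add: h'_def\<close>)
    qed (use Suc.prems(2) in simp)
  qed
qed

section \<open>Real functions of one variable of class \<open>C^k\<close>\<close>

lemma differentiable_class_on_real_SucI:
  fixes h :: "real \<Rightarrow> real"
  assumes "open S" and D: "\<And>t. t \<in> S \<Longrightarrow> (h has_real_derivative h' t) (at t)"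
    and "differentiable_class_on k S h'"
  shows "differentiable_class_on (Suc k) S h"
  by (rule differentiable_class_on_SucI[OF assms(1) D[unfolded has_field_derivative_def]])
    (auto intro!: differentiable_class_on_mult differentiable_class_on_const assms)

text \<open>Termwise differentiation yields a power series again. Convergence at some
  \<open>K\<close> beyond |x| is the form of the hypothesis that \<open>diffs\<close>
  preserves.\<close>

lemma differentiable_class_on_powser:
  fixes c :: "nat \<Rightarrow> real"
  assumes "open S" and "\<And>x. x \<in> S \<Longrightarrow> \<exists>K>\<bar>x\<bar>. summable (\<lambda>n. c n * K ^ n)"
  shows "differentiable_class_on k S (\<lambda>x. \<Sum>n. c n * x ^ n)"
  using assms(2)
proof (induction k arbitrary: c)
  case 0
  have "isCont (\<lambda>x. \<Sum>n. c n * x ^ n) x" if "x \<in> S" for x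
    using 0[OF that] isCont_powser by fastforce
  then show ?case by (auto intro: continuous_at_imp_continuous_on)
next
  case (Suc k)
  show ?case
  proof (rule differentiable_class_on_real_SucI[OF assms(1)])
    show "((\<lambda>x. \<Sum>n. c n * x ^ n) has_real_derivative (\<Sum>n. diffs c n * x ^ n)) (at x)"
      if "x \<in> S" for x
      using Suc.prems[OF that] by (auto intro: termdiffs_strong)
    have "\<exists>K>\<bar>x\<bar>. summable (\<lambda>n. diffs c n * K ^ n)" if "x \<in> S" for x
    proof -
      obtain K where K: "K > \<bar>x\<bar>" "summable (\<lambda>n. c n * K ^ n)"
        using Suc.prems[OF \<open>x \<in> S\<close>] by blast
      \<comment> \<open>The differentiated series may diverge at \<open>K\<close> itself, so the
        midpoint of |x| and \<open>K\<close> becomes the new radius.\<close>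
      have "summable (\<lambda>n. diffs c n * ((\<bar>x\<bar> + K) / 2) ^ n)"
        by (rule termdiff_converges[of _ K]) (use K in \<open>auto intro: powser_inside\<close>)
      with K(1) show ?thesis by (intro exI[of _ "(\<bar>x\<bar> + K) / 2"]) auto
    qed
    then show "differentiable_class_on k S (\<lambda>x. \<Sum>n. diffs c n * x ^ n)"
      by (rule Suc.IH)
  qed
qed

text \<open>The derivative is a polynomial in \<open>inverse\<close> itself, so the induction
  closes.\<close>

lemma differentiable_class_on_inverse: "differentiable_class_on k {0<..} (inverse :: real \<Rightarrow> real)"
proof (induction k)
  case 0
  then show ?case by (auto intro!: continuous_intros)
next
  case (Suc k)
  show ?case
  proof (rule differentiable_class_on_real_SucI)
    show "(inverse has_real_derivative - 1 * (inverse t * inverse t)) (at t)"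
      if "t \<in> {0<..}" for t :: real
      using DERIV_inverse[of t] that by (simp add: power2_eq_square)
    show "differentiable_class_on k {0<..} (\<lambda>t::real. - 1 * (inverse t * inverse t))"
      using Suc by (intro differentiable_class_on_mult differentiable_class_on_const) auto
  qed auto
qed

lemma differentiable_class_on_sqrt: "differentiable_class_on k {0<..} sqrt"
proof (induction k)
  case 0
  then show ?case by (auto intro!: continuous_intros)
next
  case (Suc k)
  show ?case
  proof (rule differentiable_class_on_real_SucI)
    show "(sqrt has_real_derivative inverse (sqrt t) * (1 / 2)) (at t)"
      if "t \<in> {0<..}" for t :: real
      using DERIV_real_sqrt[of t] that by simp
    show "differentiable_class_on k {0<..} (\<lambda>t. inverse (sqrt t) * (1 / 2))"
      using Suc
      by (intro differentiable_class_on_mult differentiable_class_on_const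
          differentiable_class_on_compose[OF _ _ differentiable_class_on_inverse]) auto
  qed auto
qed

text \<open>The derivative is composed of functions already known to be of every class. Class
  \<open>Suc k\<close> therefore follows without induction and is then weakened to
  \<open>k\<close>.\<close>

lemma differentiable_class_on_arctan: "differentiable_class_on k UNIV arctan"
proof -
  have "differentiable_class_on (Suc k) UNIV arctan"
  proof (rule differentiable_class_on_real_SucI)
    show "(arctan has_real_derivative inverse (1 + t * t)) (at t)" for t
      using DERIV_arctan[of t] by (simp add: power2_eq_square)
    show "differentiable_class_on k UNIV (\<lambda>t::real. inverse (1 + t * t))"
      by (intro differentiable_class_on_compose[OF _ _ differentiable_class_on_inverse]
          differentiable_class_on_add differentiable_class_on_const differentiable_class_on_mult
          differentiable_class_on_ident)
        (auto simp: add_pos_nonneg)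
  qed auto
  then show ?thesis by (rule differentiable_class_on_SucD)
qed

lemma differentiable_class_on_arsinh: "differentiable_class_on k UNIV (arsinh :: real \<Rightarrow> real)"
proof -
  have "differentiable_class_on (Suc k) UNIV (arsinh :: real \<Rightarrow> real)"
  proof (rule differentiable_class_on_real_SucI)
    show "(arsinh has_real_derivative inverse (sqrt (1 + t * t))) (at t)" for t :: real
      using arsinh_real_has_field_derivative[of t UNIV]
      by (simp add: power2_eq_square divide_inverse add.commute)
    have "differentiable_class_on k UNIV (\<lambda>t. sqrt (1 + t * t))"
      by (intro differentiable_class_on_compose[OF _ _ differentiable_class_on_sqrt]
          differentiable_class_on_add differentiable_class_on_const differentiable_class_on_mult
          differentiable_class_on_ident)
        (auto simp: add_pos_nonneg)
    then show "differentiable_class_on k UNIV (\<lambda>t. inverse (sqrt (1 + t * t)))"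
      by (intro differentiable_class_on_compose[OF _ _ differentiable_class_on_inverse])
        (auto simp: add_pos_nonneg)
  qed auto
  then show ?thesis by (rule differentiable_class_on_SucD)
qed

text \<open>Each function is the derivative of the other, so the induction must treat both at
  once.\<close>

lemma differentiable_class_on_sinh_cosh:
  "differentiable_class_on k UNIV (sinh :: real \<Rightarrow> real) \<and>
   differentiable_class_on k UNIV (cosh :: real \<Rightarrow> real)"
proof (induction k)
  case 0
  then show ?case by (auto intro!: continuous_intros)
next
  case (Suc k)
  have "(sinh has_real_derivative cosh t) (at t)" "(cosh has_real_derivative sinh t) (at t)"
    for t :: real
    by (auto intro!: derivative_eq_intros)
  with Suc show ?case
    by (blast intro: differentiable_class_on_real_SucI[OF open_UNIV])
qed

lemmas differentiable_class_on_sinh = differentiable_class_on_sinh_cosh[THEN conjunct1]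

section \<open>Even power series\<close>

text \<open>The entire continuation of cos (sqrt s) to all real s. It makes 0 an interior point of
  the domain, so composition with \<open>v \<bullet> v\<close> stays smooth at v = 0.\<close>

definition cos_even :: "real \<Rightarrow> real"
  where "cos_even s = (\<Sum>k. (- 1) ^ k / fact (2 * k) * s ^ k)"

text \<open>The entire continuation of sin (sqrt s) / sqrt s, with value 1 at s = 0.\<close>

definition sinc_even :: "real \<Rightarrow> real"
  where "sinc_even s = (\<Sum>k. (- 1) ^ k / fact (2 * k + 1) * s ^ k)"

text \<open>\<open>arctan (sqrt s) / sqrt s\<close> is not smooth at \<open>0\<close>, because \<open>sqrt (- s) = - sqrt s\<close>;
  the power series supplies the smooth continuation to \<open>s \<le> 0\<close>.\<close>

definition arctanc_even :: "real \<Rightarrow> real"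
  where "arctanc_even s =
    (if \<bar>s\<bar> < 1 then \<Sum>k. (- 1) ^ k / real (k * 2 + 1) * s ^ k else arctan (sqrt s) / sqrt s)"

lemma sums_cos_even: "(\<lambda>k. (- 1) ^ k / fact (2 * k) * (y * y) ^ k) sums cos y" for y :: real
  using cos_paired[of y] by (simp add: power_mult power2_eq_square)

lemma cos_even_square: "cos_even (y * y) = cos y"
  unfolding cos_even_def by (rule sums_unique[symmetric, OF sums_cos_even])

lemma sums_sinc_even:
  "(\<lambda>k. y * ((- 1) ^ k / fact (2 * k + 1) * (y * y) ^ k)) sums sin y" for y :: real
  using sin_paired[of y] by (simp add: power_mult power2_eq_square power_mult_distrib mult_ac)

lemma summable_sinc_even:
  fixes y :: real
  assumes "y \<noteq> 0"
  shows "summable (\<lambda>k. (- 1) ^ k / fact (2 * k + 1) * (y * y) ^ k)"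
  using sums_summable[OF sums_sinc_even] assms by (rule summable_mult_D)

lemma sinc_even_square: "y * sinc_even (y * y) = sin y"
proof (cases "y = 0")
  case False
  show ?thesis
    unfolding sinc_even_def suminf_mult[OF summable_sinc_even[OF False], symmetric]
    by (rule sums_unique[symmetric, OF sums_sinc_even])
qed simp

lemma sinc_even_0: "sinc_even 0 = 1"
  using powser_zero[of "\<lambda>k. (- 1) ^ k / fact (2 * k + 1) :: real"] by (simp add: sinc_even_def)

lemma differentiable_class_on_cos_even: "differentiable_class_on k UNIV cos_even"
  unfolding cos_even_def[abs_def]
proof (rule differentiable_class_on_powser)
  show "\<exists>K>\<bar>x\<bar>. summable (\<lambda>k. (- 1) ^ k / fact (2 * k) * K ^ k)" for x :: real
    \<comment> \<open>The radius |x| + 1 is the square of its own square root, where the cosine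
      series converges.\<close>
    using sums_summable[OF sums_cos_even[of "sqrt (\<bar>x\<bar> + 1)"]]
    by (intro exI[of _ "\<bar>x\<bar> + 1"]) simp
qed simp

lemma differentiable_class_on_sinc_even: "differentiable_class_on k UNIV sinc_even"
  unfolding sinc_even_def[abs_def]
proof (rule differentiable_class_on_powser)
  show "\<exists>K>\<bar>x\<bar>. summable (\<lambda>k. (- 1) ^ k / fact (2 * k + 1) * K ^ k)" for x :: real
    using summable_sinc_even[of "sqrt (\<bar>x\<bar> + 1)"]
    by (intro exI[of _ "\<bar>x\<bar> + 1"]) simp
qed simp

lemma sums_arctanc_even:
  fixes y :: real
  assumes "\<bar>y\<bar> \<le> 1"
  shows "(\<lambda>k. y * ((- 1) ^ k / real (k * 2 + 1) * (y * y) ^ k)) sums arctan y"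
proof -
  have "(\<lambda>k. (- 1) ^ k * (1 / real (k * 2 + 1) * y ^ (k * 2 + 1))) sums arctan y"
    using summable_sums[OF summable_arctan_series[OF assms]]
    unfolding arctan_series[OF assms, symmetric] .
  then show ?thesis
    by (simp add: power_mult power2_eq_square power_mult_distrib mult_ac)
qed

lemma summable_arctanc_even:
  fixes y :: real
  assumes "\<bar>y\<bar> \<le> 1" "y \<noteq> 0"
  shows "summable (\<lambda>k. (- 1) ^ k / real (k * 2 + 1) * (y * y) ^ k)"
  using sums_summable[OF sums_arctanc_even[OF assms(1)]] assms(2) by (rule summable_mult_D)

text \<open>Beyond the unit interval the closed form gives arctan |y| / |y|, which equals arctan y /
  y for either sign of y because arctan is odd.\<close>

lemma arctanc_even_square: "y * arctanc_even (y * y) = arctan y"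
proof (cases "y = 0")
  case False
  show ?thesis
  proof (cases "\<bar>y * y\<bar> < 1")
    case True
    then have "\<bar>y\<bar> \<le> 1"
      using abs_square_le_1[of y] by (simp add: power2_eq_square)
    with True show ?thesis
      using sums_unique[OF sums_arctanc_even[of y]] suminf_mult[OF summable_arctanc_even[of y]] False
      by (simp add: arctanc_even_def)
  next
    case outside: False
    then show ?thesis
      using False by (cases "y > 0") (simp_all add: arctanc_even_def arctan_minus)
  qed
qed simp

text \<open>The series is smooth on (-1, 1) and the closed form on the positive half-line. These
  open sets overlap and together cover the domain.\<close>

lemma differentiable_class_on_arctanc_even: "differentiable_class_on k {- 1<..} arctanc_even"
proof -
  have "differentiable_class_on k {- 1<..<1} (\<lambda>s. \<Sum>k. (- 1) ^ k / real (k * 2 + 1) * s ^ k)"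
  proof (rule differentiable_class_on_powser)
    show "\<exists>K>\<bar>x\<bar>. summable (\<lambda>k. (- 1) ^ k / real (k * 2 + 1) * K ^ k)"
      if "x \<in> {- 1<..<1}" for x :: real
      \<comment> \<open>The midpoint of |x| and 1 is below 1, hence so is its square root, and the
        arctangent series converges there.\<close>
      using that summable_arctanc_even[of "sqrt ((\<bar>x\<bar> + 1) / 2)"]
      by (intro exI[of _ "(\<bar>x\<bar> + 1) / 2"]) auto
  qed simp
  then have near: "differentiable_class_on k {- 1<..<1} arctanc_even"
    by (rule differentiable_class_on_cong[rotated 2]) (auto simp: arctanc_even_def)
  have "differentiable_class_on k {0<..} (\<lambda>s. arctan (sqrt s) * inverse (sqrt s))"
    by (intro differentiable_class_on_mult
        differentiable_class_on_compose[OF _ _ differentiable_class_on_arctan differentiable_class_on_sqrt]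
        differentiable_class_on_compose[OF _ _ differentiable_class_on_inverse differentiable_class_on_sqrt])
      auto
  then have "differentiable_class_on k {0<..} arctanc_even"
  proof (rule differentiable_class_on_cong[rotated 2])
    fix s :: real
    assume s: "s \<in> {0<..}"
    then show "arctan (sqrt s) * inverse (sqrt s) = arctanc_even s"
      \<comment> \<open>On (0, 1) \<open>arctanc_even\<close> is given by the series; the identity
        for arctan identifies it with the closed form there as well.\<close>
      using arctanc_even_square[of "sqrt s"] by (simp add: field_simps)
  qed simp
  from differentiable_class_on_Un[OF _ _ near this]
  show ?thesis
    by (auto elim!: differentiable_class_on_subset)
qed

section \<open>Algebras closed under doubling\<close>

text \<open>These laws pass from an algebra to its Cayley--Dickson double, although associativity does
  not; they suffice for \<open>a\<^sup>2 = 2 (Re a) a - \<bar>a\<bar>\<^sup>2\<close> and hence determine the imaginary units.\<close>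

class quadratic_algebra = cayley_dickson +
  assumes one_mult: "1 * a = a"
    and mult_one: "a * 1 = a"
    and add_mult: "(a + b) * c = a * c + b * c"
    and mult_add: "a * (b + c) = a * b + a * c"
    and scaleR_mult: "(r *\<^sub>R a) * b = r *\<^sub>R (a * b)"
    and mult_scaleR: "a * (r *\<^sub>R b) = r *\<^sub>R (a * b)"
    and conjugate_eq: "conjugate a = (2 * (a \<bullet> 1)) *\<^sub>R 1 - a"
    and conjugate_mult_self: "conjugate a * a = (a \<bullet> a) *\<^sub>R 1"
    and inner_1_1 [simp]: "1 \<bullet> 1 = 1"
    and two_le_card_Basis: "2 \<le> card Basis"

lemma uminus_mult: "(- a) * b = - (a * b)" for a b :: "'a::quadratic_algebra"
  using scaleR_mult[of "- 1" a b] by simp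

lemma mult_uminus: "a * (- b) = - (a * b)" for a b :: "'a::quadratic_algebra"
  using mult_scaleR[of a "- 1" b] by simp

lemma diff_mult: "(a - b) * c = a * c - b * c" for a b c :: "'a::quadratic_algebra"
  using add_mult[of a "- b" c] by (simp add: uminus_mult)

lemma conjugate_add: "conjugate (a + b) = conjugate a + conjugate b" for a b :: "'a::quadratic_algebra"
  by (simp add: conjugate_eq inner_add_left distrib_left scaleR_add_left algebra_simps)

lemma conjugate_scaleR: "conjugate (r *\<^sub>R a) = r *\<^sub>R conjugate a" for a :: "'a::quadratic_algebra"
  by (simp add: conjugate_eq scaleR_right_diff_distrib mult_ac)

lemma conjugate_zero: "conjugate 0 = (0 :: 'a::quadratic_algebra)"
  by (simp add: conjugate_eq)

lemma conjugate_one: "conjugate 1 = (1 :: 'a::quadratic_algebra)"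
  by (simp add: conjugate_eq inner_1_1 scaleR_2)

lemma zero_mult: "0 * a = 0" for a :: "'a::quadratic_algebra"
  using scaleR_mult[of 0] by simp

lemma mult_zero: "a * 0 = 0" for a :: "'a::quadratic_algebra"
  using mult_scaleR[of _ 0] by simp

text \<open>Substitute conjugate a = 2 (Re a) - a into conjugate a * a = |a|^2. Only distributivity
  is involved, so no associativity enters.\<close>

lemma mult_self: "a * a = (2 * (a \<bullet> 1)) *\<^sub>R a - (a \<bullet> a) *\<^sub>R 1" for a :: "'a::quadratic_algebra"
  using conjugate_mult_self[of a]
  by (simp add: conjugate_eq diff_mult scaleR_mult one_mult algebra_simps)

text \<open>Makes the set of imaginary units a Euclidean unit sphere orthogonal to 1. For one
  direction the quadratic equation is paired with 1 and with I; the second pairing forces Re I = 0,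
  because |I|^2 + 1 is positive.\<close>

lemma imaginary_units_iff: "I \<in> imaginary_units \<longleftrightarrow> I \<bullet> 1 = 0 \<and> I \<bullet> I = 1"
  for I :: "'a::quadratic_algebra"
proof
  assume "I \<in> imaginary_units"
  then have eq: "(2 * (I \<bullet> 1)) *\<^sub>R I - (I \<bullet> I) *\<^sub>R 1 = - 1"
    by (simp add: imaginary_units_def mult_self)
  from arg_cong[OF eq, of "\<lambda>a. a \<bullet> 1"] have 1: "2 * (I \<bullet> 1) * (I \<bullet> 1) - I \<bullet> I = - 1"
    by (simp add: inner_diff_left inner_1_1)
  from arg_cong[OF eq, of "\<lambda>a. a \<bullet> I"] have "(I \<bullet> 1) * (I \<bullet> I + 1) = 0"
    by (simp add: inner_diff_left inner_commute[of 1 I] algebra_simps)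
  moreover have "I \<bullet> I + 1 > 0"
    by (simp add: add_nonneg_pos)
  ultimately have "I \<bullet> 1 = 0" by simp
  with 1 show "I \<bullet> 1 = 0 \<and> I \<bullet> I = 1" by simp
qed (simp add: imaginary_units_def mult_self)

instance complex :: quadratic_algebra
proof
  fix a :: complex
  show "conjugate a = (2 * (a \<bullet> 1)) *\<^sub>R 1 - a"
    by (simp add: conjugate_complex_def complex_eq_iff inner_complex_def)
  show "conjugate a * a = (a \<bullet> a) *\<^sub>R 1"
    by (simp add: conjugate_complex_def complex_eq_iff inner_complex_def)
qed (simp_all add: algebra_simps inner_complex_def)

instance double :: (quadratic_algebra) quadratic_algebra
proof
  fix a b c :: "'a double" and r :: real
  note defs = times_double_def one_double_def plus_double_def minus_double_def uminus_double_def
    scaleR_double_def conjugate_double_def inner_double_def zero_double_def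
  note algebra = one_mult mult_one add_mult mult_add scaleR_mult
    mult_scaleR conjugate_one conjugate_zero conjugate_add conjugate_scaleR zero_mult
    mult_zero uminus_mult mult_uminus
  show "1 * a = a" "a * 1 = a"
    by (cases a, simp add: defs algebra)+
  show "(a + b) * c = a * c + b * c" "a * (b + c) = a * b + a * c"
    by (simp_all add: defs algebra)
  show "(r *\<^sub>R a) * b = r *\<^sub>R (a * b)" "a * (r *\<^sub>R b) = r *\<^sub>R (a * b)"
    by (simp_all add: defs algebra scaleR_right_diff_distrib scaleR_right_distrib)
  show "conjugate a = (2 * (a \<bullet> 1)) *\<^sub>R 1 - a"
    by (cases a) (simp add: defs conjugate_eq)
  \<comment> \<open>For a = (l, r) the left component is conj l * l + conj r * r, and the right one
    is r * conj l - r * conj l, which cancels without commuting factors.\<close>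
  show "conjugate a * a = (a \<bullet> a) *\<^sub>R 1"
    by (simp add: defs algebra conjugate_mult_self scaleR_add_left)
  show "(1 :: 'a double) \<bullet> 1 = 1"
    by (simp add: defs inner_1_1)
  show "2 \<le> card (Basis :: 'a double set)"
    using two_le_card_Basis[where 'a = 'a] by simp
qed

section \<open>The map and its inverse\<close>

definition imaginary_part :: "'a::quadratic_algebra \<Rightarrow> 'a"
  where "imaginary_part p = p - (p \<bullet> 1) *\<^sub>R 1"

text \<open>The exponential of an imaginary vector v, written without choosing a unit I with v = I
  y; this removes the ambiguity of the representation.\<close>

definition slice_exp :: "'a::quadratic_algebra \<Rightarrow> 'a"
  where "slice_exp v = cos_even (v \<bullet> v) *\<^sub>R 1 + sinc_even (v \<bullet> v) *\<^sub>R v"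

definition strip_map :: "nat \<Rightarrow> 'a::quadratic_algebra \<Rightarrow> 'a \<times> 'a"
  where "strip_map n p =
    (sinh (p \<bullet> 1) *\<^sub>R slice_exp (imaginary_part p),
     real n *\<^sub>R slice_exp ((1 / real n) *\<^sub>R imaginary_part p))"

text \<open>By the half-angle formula, \<open>tan (y / 2n) I\<close> is the imaginary part of \<open>b = n exp (I y / n)\<close>
  divided by \<open>n + Re b\<close>.\<close>

definition half_tangent :: "nat \<Rightarrow> 'a::quadratic_algebra \<times> 'a \<Rightarrow> 'a"
  where "half_tangent n q = inverse (real n + snd q \<bullet> 1) *\<^sub>R imaginary_part (snd q)"

text \<open>Recovers I y from w = I tan (y / 2n) by the factor 2n arctan |w| / |w|, expressed
  through |w|^2 to remain smooth at w = 0.\<close>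

definition strip_angle :: "nat \<Rightarrow> 'a::quadratic_algebra \<times> 'a \<Rightarrow> 'a"
  where "strip_angle n q =
    (2 * real n * arctanc_even (half_tangent n q \<bullet> half_tangent n q)) *\<^sub>R half_tangent n q"

definition strip_map_inverse :: "nat \<Rightarrow> 'a::quadratic_algebra \<times> 'a \<Rightarrow> 'a"
  where "strip_map_inverse n q =
    arsinh (fst q \<bullet> slice_exp (strip_angle n q)) *\<^sub>R 1 + strip_angle n q"

section \<open>Imaginary units, slice planes and the strip\<close>

lemma imaginary_units_inner:
  assumes "I \<in> (imaginary_units :: 'a::quadratic_algebra set)"
  shows "I \<bullet> I = 1" "I \<bullet> 1 = 0" "1 \<bullet> I = 0"
  using assms by (simp_all add: imaginary_units_iff inner_commute)

text \<open>Dimension at least two leaves a nonzero vector orthogonal to 1, which is then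
  normalised.\<close>

lemma imaginary_units_nonempty: "(imaginary_units :: 'a::quadratic_algebra set) \<noteq> {}"
proof -
  obtain v :: 'a where v: "v \<noteq> 0" "orthogonal 1 v"
    using orthogonal_to_vector_exists[of "1 :: 'a"] two_le_card_Basis[where 'a = 'a] by blast
  then have "sgn v \<in> imaginary_units"
    by (simp add: imaginary_units_iff sgn_div_norm orthogonal_def inner_commute
        power2_norm_eq_inner[symmetric] power2_eq_square)
  then show ?thesis by blast
qed

lemma bounded_linear_imaginary_part: "bounded_linear imaginary_part"
  unfolding imaginary_part_def[abs_def]
  by (intro bounded_linear_sub bounded_linear_ident bounded_linear_compose[OF bounded_linear_scaleR_left]
      bounded_linear_inner_left)

lemma imaginary_part_slice:
  "I \<in> imaginary_units \<Longrightarrow> imaginary_part (x *\<^sub>R 1 + y *\<^sub>R I) = y *\<^sub>R I"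
  by (simp add: imaginary_part_def inner_add_left imaginary_units_inner)

lemma slice_exp_unit: "I \<in> imaginary_units \<Longrightarrow> slice_exp (y *\<^sub>R I) = exp_slice I y"
  using cos_even_square[of y] sinc_even_square[of y]
  by (simp add: slice_exp_def exp_slice_def imaginary_units_inner mult.commute)

lemma exp_slice_inner_self: "I \<in> imaginary_units \<Longrightarrow> exp_slice I y \<bullet> exp_slice I y = 1"
  for I :: "'a::quadratic_algebra"
  using sin_cos_squared_add2[of y]
  by (simp add: exp_slice_def inner_add_left inner_add_right imaginary_units_inner power2_eq_square)

lemma strip_map_slice:
  "I \<in> imaginary_units \<Longrightarrow> strip_map n (x *\<^sub>R 1 + y *\<^sub>R I) =
    (sinh x *\<^sub>R exp_slice I y, real n *\<^sub>R exp_slice I (y / real n))"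
  using slice_exp_unit[of I "y / real n"]
  by (simp add: strip_map_def imaginary_part_slice slice_exp_unit inner_add_left imaginary_units_inner)

text \<open>Since \<open>strip_map\<close> involves no choice of unit, this shows that the formula
  does not depend on the representation x + I y.\<close>

lemma strip_map_formula_strip_map: "strip_map_formula n (strip_map n)"
  by (simp add: strip_map_formula_def strip_map_slice) (simp add: exp_slice_def scaleR_right_distrib)

text \<open>Replaces the existential description by a bound on a linear image of p, from which
  openness and convexity are immediate.\<close>

lemma slice_strip_eq: "slice_strip a = {p :: 'a::quadratic_algebra. norm (imaginary_part p) < a}"
proof (intro set_eqI iffI)
  fix p :: 'a
  assume "p \<in> slice_strip a"
  then obtain x y I where "p = x *\<^sub>R 1 + y *\<^sub>R I" "I \<in> imaginary_units" "- a < y" "y < a"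
    unfolding slice_strip_def by blast
  then show "p \<in> {p. norm (imaginary_part p) < a}"
    by (simp add: imaginary_part_slice norm_eq_sqrt_inner imaginary_units_inner)
next
  fix p :: 'a
  assume p: "p \<in> {p. norm (imaginary_part p) < a}"
  define v where "v = imaginary_part p"
  have pv: "p = (p \<bullet> 1) *\<^sub>R 1 + v"
    by (simp add: v_def imaginary_part_def)
  have "\<exists>I\<in>imaginary_units. v = norm v *\<^sub>R I"
  proof (cases "v = 0")
    \<comment> \<open>A real point lies in every slice, so any unit serves.\<close>
    case True
    then show ?thesis using imaginary_units_nonempty by auto
  next
    case False
    have "v \<bullet> 1 = 0"
      by (simp add: v_def imaginary_part_def inner_diff_left)
    with False have "sgn v \<in> imaginary_units"
      by (simp add: imaginary_units_iff sgn_div_norm power2_norm_eq_inner[symmetric] power2_eq_square)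
    with False show ?thesis by (intro bexI[of _ "sgn v"]) (simp add: sgn_div_norm)
  qed
  then obtain I where I: "I \<in> imaginary_units" "v = norm v *\<^sub>R I" by blast
  have "p = (p \<bullet> 1) *\<^sub>R 1 + norm v *\<^sub>R I"
    using pv I(2) by simp
  moreover have "- a < norm v" "norm v < a"
    using p norm_ge_zero[of v] unfolding v_def mem_Collect_eq by linarith+
  ultimately show "p \<in> slice_strip a"
    using I(1) unfolding slice_strip_def by blast
qed

lemma slice_plane_eq_span: "slice_plane I = span {1, I}"
  by (auto simp: slice_plane_def span_insert span_singleton set_eq_iff algebra_simps)

lemma subspace_slice_plane: "subspace (slice_plane I)"
  unfolding slice_plane_eq_span by (rule subspace_span)

lemma open_slice_strip: "open (slice_strip a :: 'a::quadratic_algebra set)"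
  unfolding slice_strip_eq
  by (intro open_Collect_less continuous_intros bounded_linear.continuous_on[OF bounded_linear_imaginary_part])

lemma convex_slice_strip: "convex (slice_strip a :: 'a::quadratic_algebra set)"
proof -
  have "slice_strip a = imaginary_part -` ball (0 :: 'a) a"
    by (auto simp: slice_strip_eq)
  then show ?thesis
    by (simp add: convex_linear_vimage bounded_linear.linear bounded_linear_imaginary_part)
qed

lemma slice_domain_slice_strip:
  assumes "0 < a"
  shows "slice_domain (slice_strip a :: 'a::quadratic_algebra set)"
proof -
  have real: "x *\<^sub>R 1 \<in> (slice_strip a :: 'a set)" for x
    using assms by (simp add: slice_strip_eq imaginary_part_def)
  have "slice_strip a \<inter> slice_plane I \<noteq> ({} :: 'a set)" for I
    using real[of 0] subspace_0[OF subspace_slice_plane] by auto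
  then show ?thesis
    using real open_slice_strip[where 'a = 'a] convex_slice_strip[where 'a = 'a]
    by (auto simp: slice_domain_def convex_connected convex_Int subspace_imp_convex
        subspace_slice_plane openin_open_Int Int_commute)
qed

section \<open>The left inverse on the image of the strip\<close>

text \<open>The half angle t = y / 2n lies in (-pi/2, pi/2), where arctan inverts tan. There also 1
  + cos 2t = 2 (cos t)^2 > 0, so the denominator n + Re b in \<open>half_tangent\<close> is
  positive.\<close>

lemma strip_map_inverse_strip_map_slice:
  fixes I :: "'a::quadratic_algebra"
  assumes "0 < n" "I \<in> imaginary_units" "- (pi * real n) < y" "y < pi * real n"
  shows "strip_map_inverse n (strip_map n (x *\<^sub>R 1 + y *\<^sub>R I)) = x *\<^sub>R 1 + y *\<^sub>R I"
    and "- real n < snd (strip_map n (x *\<^sub>R 1 + y *\<^sub>R I)) \<bullet> 1"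
proof -
  define t where "t = y / (2 * real n)"
  have y: "y / real n = 2 * t" "y = 2 * real n * t"
    using assms(1) by (simp_all add: t_def)
  have t: "- (pi / 2) < t" "t < pi / 2"
    using assms by (simp_all add: t_def field_simps)
  define q where "q = strip_map n (x *\<^sub>R 1 + y *\<^sub>R I)"
  have q: "fst q = sinh x *\<^sub>R exp_slice I y" "snd q = real n *\<^sub>R exp_slice I (2 * t)"
    using strip_map_slice[OF assms(2)] y(1) by (simp_all add: q_def)
  have re: "snd q \<bullet> 1 = real n * cos (2 * t)"
    by (simp add: q exp_slice_def inner_add_left imaginary_units_inner assms(2))
  have cos: "0 < cos t"
    using t by (rule cos_gt_zero_pi)
  then have pos: "0 < 1 + cos (2 * t)"
    by (simp add: cos_double_cos)
  then have "0 < real n * (1 + cos (2 * t))"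
    using assms(1) by simp
  then show "- real n < snd q \<bullet> 1"
    unfolding re by (simp add: algebra_simps)
  have "imaginary_part (snd q) = (real n * sin (2 * t)) *\<^sub>R I"
    using imaginary_part_slice[OF assms(2), of "real n * cos (2 * t)" "real n * sin (2 * t)"]
    by (simp add: q exp_slice_def scaleR_right_distrib)
  moreover have "inverse (real n + real n * cos (2 * t)) * (real n * sin (2 * t)) = tan t"
  proof -
    have "inverse (real n + real n * cos (2 * t)) * (real n * sin (2 * t)) =
        (real n * sin (2 * t)) / (real n * (cos (2 * t) + 1))"
      by (simp add: divide_inverse distrib_left mult.commute add.commute)
    then show ?thesis
      using assms(1) by (simp add: tan_half[of t])
  qed
  ultimately have half: "half_tangent n q = tan t *\<^sub>R I"
    by (simp add: half_tangent_def re)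
  have angle: "strip_angle n q = y *\<^sub>R I"
    using arctanc_even_square[of "tan t"] arctan_tan[OF t]
    by (simp add: strip_angle_def half imaginary_units_inner assms(2) y(2) mult_ac)
  \<comment> \<open>The first component is sinh x times exp (I y), a unit vector, so pairing with
    that vector isolates sinh x.\<close>
  have "fst q \<bullet> slice_exp (strip_angle n q) = sinh x"
    by (simp add: angle slice_exp_unit[OF assms(2)] q exp_slice_inner_self[OF assms(2)])
  then show "strip_map_inverse n q = x *\<^sub>R 1 + y *\<^sub>R I"
    by (simp add: strip_map_inverse_def angle arsinh_sinh_real)
qed

lemma strip_map_inverse_strip_map:
  fixes p :: "'a::quadratic_algebra"
  assumes "0 < n" "p \<in> slice_strip (pi * real n)"
  shows "strip_map_inverse n (strip_map n p) = p" and "- real n < snd (strip_map n p) \<bullet> 1"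
  using assms strip_map_inverse_strip_map_slice[OF assms(1)] unfolding slice_strip_def by auto

section \<open>Smoothness of the map and of its inverse\<close>

lemma differentiable_class_on_slice_exp:
  assumes "open S" "differentiable_class_on k S f"
  shows "differentiable_class_on k S (\<lambda>p. slice_exp (f p))"
proof -
  have "differentiable_class_on k S (\<lambda>p. f p \<bullet> f p)"
    using assms by (intro differentiable_class_on_inner)
  note 1 = differentiable_class_on_compose[OF assms(1) subset_UNIV differentiable_class_on_cos_even this]
    differentiable_class_on_compose[OF assms(1) subset_UNIV differentiable_class_on_sinc_even this]
  show ?thesis
    unfolding slice_exp_def using assms 1
    by (intro differentiable_class_on_add differentiable_class_on_scaleR differentiable_class_on_const)
qed

lemma differentiable_class_on_strip_map: "differentiable_class_on k UNIV (strip_map n)"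
proof -
  have im: "differentiable_class_on k UNIV (imaginary_part :: 'a::quadratic_algebra \<Rightarrow> 'a)"
    by (rule differentiable_class_on_linear[OF open_UNIV bounded_linear_imaginary_part
          differentiable_class_on_ident[OF open_UNIV]])
  have re: "differentiable_class_on k UNIV (\<lambda>p :: 'a. p \<bullet> 1)"
    by (rule differentiable_class_on_linear[OF open_UNIV bounded_linear_inner_left
          differentiable_class_on_ident[OF open_UNIV]])
  have "differentiable_class_on k UNIV (\<lambda>p :: 'a. sinh (p \<bullet> 1))"
    by (rule differentiable_class_on_compose[OF open_UNIV subset_UNIV differentiable_class_on_sinh re])
  then show ?thesis
    unfolding strip_map_def[abs_def] using im
    by (intro differentiable_class_on_Pair differentiable_class_on_scaleR
        differentiable_class_on_slice_exp differentiable_class_on_const open_UNIV)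
qed

lemma open_snd_inner_greater: "open {q :: 'a::quadratic_algebra \<times> 'a. c < snd q \<bullet> 1}"
  by (intro open_Collect_less continuous_intros)

text \<open>The open half-space Re b > -n keeps the denominator in the domain of
  \<open>inverse\<close>; the argument of \<open>arctanc_even\<close> is a squared norm and so
  always exceeds -1.\<close>

lemma differentiable_class_on_strip_map_inverse:
  "differentiable_class_on k {q :: 'a::quadratic_algebra \<times> 'a. - real n < snd q \<bullet> 1}
    (strip_map_inverse n)"
proof -
  define S where "S = {q :: 'a \<times> 'a. - real n < snd q \<bullet> 1}"
  have S: "open S"
    unfolding S_def by (rule open_snd_inner_greater)
  have fst: "differentiable_class_on k S fst" and snd: "differentiable_class_on k S snd"
    using differentiable_class_on_linear[OF S bounded_linear_fst differentiable_class_on_ident[OF S]]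
      differentiable_class_on_linear[OF S bounded_linear_snd differentiable_class_on_ident[OF S]]
    by simp_all
  have re: "differentiable_class_on k S (\<lambda>q. real n + snd q \<bullet> 1)"
    by (intro differentiable_class_on_add differentiable_class_on_inner differentiable_class_on_const S snd)
  have "differentiable_class_on k S (\<lambda>q. inverse (real n + snd q \<bullet> 1))"
    by (rule differentiable_class_on_compose[OF S _ differentiable_class_on_inverse re])
      (auto simp: S_def)
  moreover have "differentiable_class_on k S (\<lambda>q. imaginary_part (snd q))"
    by (rule differentiable_class_on_linear[OF S bounded_linear_imaginary_part snd])
  ultimately have w: "differentiable_class_on k S (half_tangent n)"
    unfolding half_tangent_def[abs_def] by (intro differentiable_class_on_scaleR S)
  have "differentiable_class_on k S (\<lambda>q. arctanc_even (half_tangent n q \<bullet> half_tangent n q))"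
    by (rule differentiable_class_on_compose[OF S _ differentiable_class_on_arctanc_even
          differentiable_class_on_inner[OF S w w]])
      (auto intro: less_le_trans[of "- 1" 0])
  then have v: "differentiable_class_on k S (strip_angle n)"
    unfolding strip_angle_def[abs_def] using w
    by (intro differentiable_class_on_scaleR differentiable_class_on_mult differentiable_class_on_const S)
  have "differentiable_class_on k S (\<lambda>q. fst q \<bullet> slice_exp (strip_angle n q))"
    by (intro differentiable_class_on_inner differentiable_class_on_slice_exp S fst v)
  note differentiable_class_on_compose[OF S subset_UNIV differentiable_class_on_arsinh this]
  then show ?thesis
    unfolding strip_map_inverse_def[abs_def] S_def[symmetric] using v
    by (intro differentiable_class_on_add differentiable_class_on_scaleR differentiable_class_on_const S)
qed

lemma differentiable_class_on_imp_smooth_map_on: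
  assumes "open U" "X \<subseteq> U" "\<And>k. differentiable_class_on k U g" "\<And>q. q \<in> X \<Longrightarrow> g q = f q"
  shows "smooth_map_on X f"
  unfolding smooth_map_on_def using assms by blast

section \<open>The differential and its conformality\<close>

text \<open>The transpose of the restriction is the adjoint followed by the orthogonal projection
  \<open>P\<close> onto \<open>V\<close>, so it suffices that \<open>T\<close> scales scalar
  products on \<open>V\<close>.\<close>

lemma conformal_onI:
  fixes T :: "'a::euclidean_space \<Rightarrow> 'b::euclidean_space"
  assumes V: "subspace V" and T: "linear T" and "k \<noteq> 0"
    and inner: "\<And>u v. u \<in> V \<Longrightarrow> v \<in> V \<Longrightarrow> T u \<bullet> T v = k * (u \<bullet> v)"
  shows "conformal_on V T"
proof -
  have "\<exists>y\<in>V. \<forall>v\<in>V. v \<bullet> y = v \<bullet> x" for x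
  proof -
    obtain y z where yz: "y \<in> span V" "\<And>w. w \<in> span V \<Longrightarrow> orthogonal z w" "x = y + z"
      using orthogonal_subspace_decomp_exists by blast
    have "v \<bullet> y = v \<bullet> x" if "v \<in> V" for v
      using yz(2)[OF span_base[OF that]] yz(3)
      by (simp add: inner_add_right orthogonal_def inner_commute)
    moreover have "y \<in> V" using yz(1) V by (simp add: span_eq_iff[THEN iffD2])
    ultimately show ?thesis by blast
  qed
  then obtain P where P: "\<And>x. P x \<in> V" "\<And>x v. v \<in> V \<Longrightarrow> v \<bullet> P x = v \<bullet> x"
    by metis
  define T' where "T' w = P (adjoint T w)" for w
  have adj: "T v \<bullet> w = v \<bullet> T' w" if "v \<in> V" for v w
    by (simp add: T'_def P(2)[OF that] adjoint_works[OF T])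
  have "T' (T v) = k *\<^sub>R v" if "v \<in> V" for v
  proof -
    define d where "d = T' (T v) - k *\<^sub>R v"
    have "d \<in> V"
      unfolding d_def using that by (intro subspace_diff[OF V] subspace_scale[OF V]) (simp_all add: T'_def P(1))
    \<comment> \<open>Since d lies in \<open>V\<close>, d . T' (T v) = T d . T v = k (d . v), so d
      is orthogonal to itself.\<close>
    then have "d \<bullet> d = 0"
      using adj[of d "T v"] inner[OF _ that, of d]
      by (subst (2) d_def) (simp add: inner_diff_right)
    then show ?thesis by (simp add: d_def)
  qed
  then show ?thesis
    unfolding conformal_on_def using T \<open>k \<noteq> 0\<close> adj P(1)
    by (intro conjI exI[of _ T'] exI[of _ k]) (auto simp: T'_def)
qed

lemma has_vector_derivative_along_line:
  assumes "(f has_derivative T) (at p)"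
  shows "((\<lambda>t. f (p + t *\<^sub>R v)) has_vector_derivative T v) (at 0)"
proof -
  have "((\<lambda>t. p + t *\<^sub>R v) has_derivative (\<lambda>t. t *\<^sub>R v)) (at 0)"
    by (auto intro!: derivative_eq_intros)
  from has_derivative_compose[OF this, of f T] assms
  have "((\<lambda>t. f (p + t *\<^sub>R v)) has_derivative (\<lambda>t. T (t *\<^sub>R v))) (at 0)"
    by simp
  then show ?thesis
    by (simp add: has_vector_derivative_def linear_scale[OF has_derivative_linear[OF assms]])
qed

text \<open>By orthogonality |v + t h|^2 = |v|^2 + t^2 |h|^2 is stationary at t = 0. Both
  coefficients of \<open>slice_exp\<close> then have derivative 0, and only the variation of the
  vector contributes.\<close>

lemma slice_exp_has_vector_derivative_orthogonal:
  fixes v h :: "'a::quadratic_algebra"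
  assumes "v \<bullet> h = 0"
  shows "((\<lambda>t. slice_exp (v + t *\<^sub>R h)) has_vector_derivative sinc_even (v \<bullet> v) *\<^sub>R h) (at 0)"
proof -
  have sq: "(v + t *\<^sub>R h) \<bullet> (v + t *\<^sub>R h) = v \<bullet> v + t * t * (h \<bullet> h)" for t
    using assms by (simp add: inner_add_left inner_add_right inner_commute)
  have *: "((\<lambda>t. F (v \<bullet> v + t * t * (h \<bullet> h))) has_real_derivative 0) (at 0)"
    if "differentiable_class_on 1 UNIV F" for F
  proof -
    have "F differentiable at (v \<bullet> v)"
      using that by simp
    then obtain d where "(F has_real_derivative d) (at (v \<bullet> v + 0 * 0 * (h \<bullet> h)))"
      by (auto simp: real_differentiable_def)
    moreover have "((\<lambda>t. v \<bullet> v + t * t * (h \<bullet> h)) has_real_derivative 0) (at 0)"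
      by (auto intro!: derivative_eq_intros)
    ultimately show ?thesis
      using DERIV_chain2[of F d "\<lambda>t. v \<bullet> v + t * t * (h \<bullet> h)" 0 0 UNIV] by simp
  qed
  note C = *[OF differentiable_class_on_cos_even] and S = *[OF differentiable_class_on_sinc_even]
  have "((\<lambda>t. v + t *\<^sub>R h) has_vector_derivative h) (at 0)"
    by (auto intro!: derivative_eq_intros)
  from has_vector_derivative_add[OF has_vector_derivative_scaleR[OF C has_vector_derivative_const[of "1 :: 'a"]]
      has_vector_derivative_scaleR[OF S this]]
  show ?thesis
    by (simp add: slice_exp_def sq)
qed

text \<open>The differential is given, so its values can be read off along lines through p and
  identified by uniqueness of vector derivatives. The directions 1 and I stay in one slice, where
  the explicit formula holds; for h the imaginary part moves orthogonally to I y.\<close>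

lemma strip_map_derivative:
  fixes I :: "'a::quadratic_algebra"
  assumes n: "0 < n" and I: "I \<in> imaginary_units"
    and T: "(strip_map n has_derivative T) (at (x *\<^sub>R 1 + y *\<^sub>R I))"
  shows "T 1 = (cosh x *\<^sub>R exp_slice I y, 0)"
    and "T I = (sinh x *\<^sub>R (- sin y *\<^sub>R 1 + cos y *\<^sub>R I),
      - sin (y / real n) *\<^sub>R 1 + cos (y / real n) *\<^sub>R I)"
    and "h \<bullet> 1 = 0 \<Longrightarrow> h \<bullet> I = 0 \<Longrightarrow>
      T h = ((sinh x * sinc_even (y * y)) *\<^sub>R h, sinc_even (y / real n * (y / real n)) *\<^sub>R h)"
proof -
  define p where "p = x *\<^sub>R 1 + y *\<^sub>R I"
  note line = has_vector_derivative_along_line[OF T[folded p_def]]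
  have sinh: "((\<lambda>t. sinh (x + t)) has_real_derivative cosh x) (at 0)"
    by (auto intro!: derivative_eq_intros)
  have "p + t *\<^sub>R 1 = (x + t) *\<^sub>R 1 + y *\<^sub>R I" for t
    by (simp add: p_def algebra_simps)
  then have line_1: "(\<lambda>t. strip_map n (p + t *\<^sub>R 1)) =
      (\<lambda>t. sinh (x + t) *\<^sub>R (exp_slice I y, 0) + (0, real n *\<^sub>R exp_slice I (y / real n)))"
    by (simp add: strip_map_slice[OF I])
  have "((\<lambda>t. strip_map n (p + t *\<^sub>R 1)) has_vector_derivative
      sinh (x + 0) *\<^sub>R 0 + cosh x *\<^sub>R (exp_slice I y, 0) + 0) (at 0)"
    unfolding line_1
    by (rule has_vector_derivative_add[OF
          has_vector_derivative_scaleR[OF sinh has_vector_derivative_const] has_vector_derivative_const])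
  from vector_derivative_unique_at[OF line this]
  show "T 1 = (cosh x *\<^sub>R exp_slice I y, 0)" by simp
  have exp: "((\<lambda>t. exp_slice I (a + t * b)) has_vector_derivative
      b *\<^sub>R (- sin a *\<^sub>R 1 + cos a *\<^sub>R I)) (at 0)" for a b
    unfolding exp_slice_def
    by (auto intro!: derivative_eq_intros simp: algebra_simps)
  have "p + t *\<^sub>R I = x *\<^sub>R 1 + (y + t * 1) *\<^sub>R I" for t
    by (simp add: p_def algebra_simps)
  \<comment> \<open>The arguments are written as a + t * b to match \<open>exp\<close>, with speeds
    b = 1 and b = 1 / n; the latter cancels the factor n of the second component.\<close>
  then have line_I: "(\<lambda>t. strip_map n (p + t *\<^sub>R I)) =
      (\<lambda>t. (sinh x *\<^sub>R exp_slice I (y + t * 1),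
        real n *\<^sub>R exp_slice I (y / real n + t * (1 / real n))))"
    by (simp only: strip_map_slice[OF I]) (simp add: add_divide_distrib)
  have "((\<lambda>t. strip_map n (p + t *\<^sub>R I)) has_vector_derivative
      (sinh x *\<^sub>R 1 *\<^sub>R (- sin y *\<^sub>R 1 + cos y *\<^sub>R I),
       real n *\<^sub>R (1 / real n) *\<^sub>R (- sin (y / real n) *\<^sub>R 1 + cos (y / real n) *\<^sub>R I))) (at 0)"
    unfolding line_I
    by (intro has_vector_derivative_Pair bounded_linear.has_vector_derivative[OF bounded_linear_scaleR_right] exp)
  from vector_derivative_unique_at[OF line this] n
  show "T I = (sinh x *\<^sub>R (- sin y *\<^sub>R 1 + cos y *\<^sub>R I),
      - sin (y / real n) *\<^sub>R 1 + cos (y / real n) *\<^sub>R I)"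
    by simp
  assume h: "h \<bullet> 1 = 0" "h \<bullet> I = 0"
  then have "imaginary_part (p + t *\<^sub>R h) = y *\<^sub>R I + t *\<^sub>R h" "(p + t *\<^sub>R h) \<bullet> 1 = x" for t
    by (simp_all add: p_def imaginary_part_def inner_add_left imaginary_units_inner[OF I])
  then have line_h: "(\<lambda>t. strip_map n (p + t *\<^sub>R h)) =
      (\<lambda>t. (sinh x *\<^sub>R slice_exp (y *\<^sub>R I + t *\<^sub>R h),
        real n *\<^sub>R slice_exp ((y / real n) *\<^sub>R I + t *\<^sub>R (1 / real n) *\<^sub>R h)))"
    by (simp add: strip_map_def scaleR_right_distrib)
  have "((\<lambda>t. strip_map n (p + t *\<^sub>R h)) has_vector_derivative
      (sinh x *\<^sub>R sinc_even ((y *\<^sub>R I) \<bullet> (y *\<^sub>R I)) *\<^sub>R h,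
       real n *\<^sub>R sinc_even (((y / real n) *\<^sub>R I) \<bullet> ((y / real n) *\<^sub>R I)) *\<^sub>R (1 / real n) *\<^sub>R h)) (at 0)"
    unfolding line_h using h
    by (intro has_vector_derivative_Pair bounded_linear.has_vector_derivative[OF bounded_linear_scaleR_right]
        slice_exp_has_vector_derivative_orthogonal) (simp_all add: inner_commute)
  from vector_derivative_unique_at[OF line this] n
  show "T h = ((sinh x * sinc_even (y * y)) *\<^sub>R h,
      sinc_even (y / real n * (y / real n)) *\<^sub>R h)"
    by (simp add: imaginary_units_inner[OF I])
qed

text \<open>On the slice plane the factor is (cosh x)^2 = (sinh x)^2 + 1, the unit speed of the
  second component supplying the 1. On the complement it is s^2 + c^2, which may differ from
  it.\<close>

lemma slice_conformal_strip_map: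
  fixes I :: "'a::quadratic_algebra"
  assumes n: "0 < n" and I: "I \<in> imaginary_units" and y: "- (pi * real n) < y" "y < pi * real n"
    and T: "(strip_map n has_derivative T) (at (x *\<^sub>R 1 + y *\<^sub>R I))"
  shows "conformal_on (slice_plane I) T" and "conformal_on ((slice_plane I)\<^sup>\<bottom>) T" and "inj T"
proof -
  have lin: "linear T"
    using T by (rule has_derivative_linear)
  define s c where "s = sinh x * sinc_even (y * y)"
    and "c = sinc_even (y / real n * (y / real n))"
  define A B where "A = T 1" and "B = T I"
  note IJ = imaginary_units_inner[OF I]
  note D = strip_map_derivative[OF n I T]
  have cosh: "cosh x * cosh x = 1 + sinh x * sinh x"
    using cosh_square_eq[of x] by (simp add: power2_eq_square)
  have normal: "(cos t *\<^sub>R I - sin t *\<^sub>R 1) \<bullet> (cos t *\<^sub>R I - sin t *\<^sub>R 1) = 1" for t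
    using sin_cos_squared_add2[of t]
    by (simp add: inner_diff_left inner_diff_right IJ power2_eq_square)
  have AA: "A \<bullet> A = cosh x * cosh x"
    by (simp add: A_def D(1) exp_slice_inner_self[OF I])
  have AB: "A \<bullet> B = 0"
    by (simp add: A_def B_def D(1,2) exp_slice_def inner_add_left inner_diff_right IJ)
  have BB: "B \<bullet> B = cosh x * cosh x"
    by (simp add: B_def D(2) normal cosh)
  \<comment> \<open>Here the width of the strip enters: c (y / n) = sin (y / n) has no zero with 0 <
    |y / n| < pi. As s vanishes for x = 0, the complement depends on c.\<close>
  have c: "c \<noteq> 0"
  proof (cases "y = 0")
    case True
    then show ?thesis by (simp add: c_def sinc_even_0)
  next
    case False
    have "- pi < y / real n" "y / real n < pi"
      using n y by (simp_all add: field_simps)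
    then have "sin (y / real n) \<noteq> 0"
      using sin_eq_0_pi[of "y / real n"] False n by auto
    then show ?thesis
      unfolding c_def sinc_even_square[of "y / real n", symmetric] by simp
  qed
  have Th: "T h = (s *\<^sub>R h, c *\<^sub>R h)" if "h \<bullet> 1 = 0" "h \<bullet> I = 0" for h
    using D(3)[OF that] by (simp add: s_def c_def)
  have perp: "h \<bullet> 1 = 0" "h \<bullet> I = 0" if "h \<in> (slice_plane I)\<^sup>\<bottom>" for h
  proof -
    have "1 \<in> slice_plane I" "I \<in> slice_plane I"
      by (simp_all add: slice_plane_eq_span span_base)
    with that show "h \<bullet> 1 = 0" "h \<bullet> I = 0"
      by (auto simp: orthogonal_comp_def orthogonal_def inner_commute)
  qed
  have Tplane: "T (a *\<^sub>R 1 + b *\<^sub>R I) = a *\<^sub>R A + b *\<^sub>R B" for a b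
    by (simp add: A_def B_def linear_add[OF lin] linear_scale[OF lin])
  show "conformal_on (slice_plane I) T"
  proof (rule conformal_onI[OF subspace_slice_plane lin])
    show "cosh x * cosh x \<noteq> 0" by simp
    fix u v
    assume "u \<in> slice_plane I" "v \<in> slice_plane I"
    then obtain a b a' b' where
      uv: "u = a *\<^sub>R 1 + b *\<^sub>R I" "v = a' *\<^sub>R 1 + b' *\<^sub>R I"
      unfolding slice_plane_def by blast
    have "T u \<bullet> T v = cosh x * cosh x * (a * a' + b * b')"
      by (simp add: uv Tplane inner_add_left inner_add_right AA AB BB inner_commute[of B A] algebra_simps)
    also have "a * a' + b * b' = u \<bullet> v"
      by (simp add: uv inner_add_left inner_add_right IJ)
    finally show "T u \<bullet> T v = cosh x * cosh x * (u \<bullet> v)" .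
  qed
  show "conformal_on ((slice_plane I)\<^sup>\<bottom>) T"
  proof (rule conformal_onI[OF subspace_orthogonal_comp lin])
    show "s * s + c * c \<noteq> 0"
      using c by simp
    show "T u \<bullet> T v = (s * s + c * c) * (u \<bullet> v)"
      if "u \<in> (slice_plane I)\<^sup>\<bottom>" "v \<in> (slice_plane I)\<^sup>\<bottom>" for u v
      using that by (simp add: Th perp algebra_simps)
  qed
  show "inj T"
  proof (rule linear_injective_0[OF lin, THEN iffD2], intro allI impI)
    fix u
    assume u: "T u = 0"
    \<comment> \<open>This is the component of u orthogonal to the slice plane, since 1 and I are
      orthonormal.\<close>
    define h where "h = u - (u \<bullet> 1) *\<^sub>R 1 - (u \<bullet> I) *\<^sub>R I"
    have h: "h \<bullet> 1 = 0" "h \<bullet> I = 0"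
      by (simp_all add: h_def inner_diff_left IJ)
    have dec: "u = (u \<bullet> 1) *\<^sub>R 1 + (u \<bullet> I) *\<^sub>R I + h"
      by (simp add: h_def)
    then have Tu: "(u \<bullet> 1) *\<^sub>R A + (u \<bullet> I) *\<^sub>R B + T h = 0"
      using u Tplane[of "u \<bullet> 1" "u \<bullet> I"] linear_add[OF lin, of _ h] by metis
    \<comment> \<open>The images of the plane and of its complement are orthogonal, so pairing
      \<open>Tu\<close> with \<open>A\<close> and \<open>B\<close> isolates the two plane
      coordinates.\<close>
    have "T h \<bullet> A = 0" "T h \<bullet> B = 0"
      by (simp_all add: Th[OF h] A_def B_def D(1,2) exp_slice_def inner_add_right inner_diff_right h)
    with arg_cong[OF Tu, of "\<lambda>a. a \<bullet> A"] arg_cong[OF Tu, of "\<lambda>a. a \<bullet> B"]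
    have "u \<bullet> 1 = 0" "u \<bullet> I = 0"
      by (simp_all add: inner_add_left AA AB BB inner_commute[of B A])
    with Tu dec show "u = 0"
      using c by (simp add: Th[OF h] zero_prod_def)
  qed
qed

section \<open>From the explicit map to every map given by the formula\<close>

lemma slice_isothermal_parameterization_strip_map:
  fixes f :: "'a::quadratic_algebra \<Rightarrow> 'a \<times> 'a"
  assumes n: "0 < n" and eq: "\<And>p. p \<in> slice_strip (pi * real n) \<Longrightarrow> f p = strip_map n p"
  shows "slice_isothermal_parameterization (slice_strip (pi * real n) :: 'a set) f"
proof -
  let ?S = "slice_strip (pi * real n) :: 'a set"
  have diff: "differentiable_class_on k ?S f" for k
    by (rule differentiable_class_on_cong[OF open_slice_strip])
      (auto simp: eq intro: differentiable_class_on_subset[OF differentiable_class_on_strip_map])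
  \<comment> \<open>The formula fixes \<open>f\<close> only on the strip; because the strip is open,
    this already determines the derivative at each of its points.\<close>
  have D: "(strip_map n has_derivative frechet_derivative f (at p)) (at p)" if "p \<in> ?S" for p
  proof (rule has_derivative_transform_within_open[OF _ open_slice_strip that eq])
    show "(f has_derivative frechet_derivative f (at p)) (at p)"
      using diff[of 1] that by (simp add: frechet_derivative_works[symmetric])
  qed
  have slice: "- (pi * real n) < y" "y < pi * real n"
    if "I \<in> imaginary_units" "x *\<^sub>R 1 + y *\<^sub>R I \<in> ?S" for x y I
    using that by (auto simp: slice_strip_eq imaginary_part_slice norm_eq_sqrt_inner imaginary_units_inner)
  have "inj_on f ?S"
    using strip_map_inverse_strip_map(1)[OF n, where 'a = 'a] eq by (metis inj_onI)
  moreover have "inj (frechet_derivative f (at p))" if p: "p \<in> ?S" for p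
  proof -
    obtain x y I where "p = x *\<^sub>R 1 + y *\<^sub>R I" "I \<in> imaginary_units"
      "- (pi * real n) < y" "y < pi * real n"
      using p unfolding slice_strip_def by blast
    with slice_conformal_strip_map(3)[OF n, where I = I and x = x and y = y] D[OF p] show ?thesis by blast
  qed
  moreover have "slice_isothermal ?S f"
    unfolding slice_isothermal_def
    using slice_domain_slice_strip[of "pi * real n"] n diff[of 1]
      slice_conformal_strip_map(1,2)[OF n _ slice D]
    by auto
  ultimately show ?thesis
    unfolding slice_isothermal_parameterization_def by blast
qed

text \<open>Smoothness on the image requires extensions to open sets of the ambient space:
  \<open>strip_map_inverse\<close> is defined and smooth on a half-space containing the image, so
  one extension serves at every point.\<close>

lemma diffeomorphic_strip_map_image:
  fixes f :: "'a::quadratic_algebra \<Rightarrow> 'a \<times> 'a"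
  assumes n: "0 < n" and eq: "\<And>p. p \<in> slice_strip (pi * real n) \<Longrightarrow> f p = strip_map n p"
  shows "diffeomorphic (f ` slice_strip (pi * real n))
    (slice_strip (pi * real n) :: 'a set)"
proof -
  let ?S = "slice_strip (pi * real n) :: 'a set"
  let ?U = "{q :: 'a \<times> 'a. - real n < snd q \<bullet> 1}"
  have image: "f ` ?S \<subseteq> ?U"
    using strip_map_inverse_strip_map(2)[OF n] by (auto simp: eq)
  have inverse: "strip_map_inverse n (f p) = p" if "p \<in> ?S" for p
    using strip_map_inverse_strip_map(1)[OF n that] by (simp add: eq[OF that])
  have "smooth_map_on (f ` ?S) (strip_map_inverse n)"
    by (rule differentiable_class_on_imp_smooth_map_on[OF open_snd_inner_greater image
          differentiable_class_on_strip_map_inverse]) simp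
  moreover have "smooth_map_on ?S f"
    by (rule differentiable_class_on_imp_smooth_map_on[OF open_UNIV subset_UNIV
          differentiable_class_on_strip_map]) (simp add: eq)
  moreover have "homeomorphism (f ` ?S) ?S (strip_map_inverse n) f"
  proof (rule homeomorphismI)
    show "continuous_on (f ` ?S) (strip_map_inverse n)"
      by (rule continuous_on_subset[OF differentiable_class_on_imp_continuous_on[OF
            differentiable_class_on_strip_map_inverse[of 0]] image])
    have "continuous_on ?S (strip_map n)"
      using differentiable_class_on_strip_map[of 0 n] by (auto intro: continuous_on_subset)
    then show "continuous_on ?S f"
      by (simp add: eq cong: continuous_on_cong)
  qed (auto simp: inverse)
  ultimately show ?thesis
    unfolding diffeomorphic_def by blast
qed

lemma strip_map_formulaD:
  fixes f :: "'a::quadratic_algebra \<Rightarrow> 'a \<times> 'a"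
  assumes "strip_map_formula n f" "p \<in> slice_strip (pi * real n)"
  shows "f p = strip_map n p"
  using assms strip_map_formula_strip_map[of n, where 'a = 'a]
  unfolding strip_map_formula_def slice_strip_def by auto

lemma strip_map_formula_imp_isothermal_diffeomorphic:
  fixes f :: "'a::quadratic_algebra \<Rightarrow> 'a \<times> 'a"
  assumes n: "0 < n" and f: "strip_map_formula n f"
  shows "parameterized_hypercomplex_riemann_manifold TYPE('a) (f ` slice_strip (pi * real n)) \<and>
    diffeomorphic (f ` slice_strip (pi * real n)) (slice_strip (pi * real n) :: 'a set) \<and>
    slice_isothermal_parameterization (slice_strip (pi * real n)) f"
  unfolding parameterized_hypercomplex_riemann_manifold_def
  using slice_isothermal_parameterization_strip_map[OF n strip_map_formulaD[OF f]]
    diffeomorphic_strip_map_image[OF n strip_map_formulaD[OF f]]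
  by blast

theorem proposition5p8:
  fixes n :: nat
  assumes "1 < n"
  shows "(\<exists>f :: quaternion \<Rightarrow> quaternion \<times> quaternion. strip_map_formula n f) \<and>
    (\<forall>f :: quaternion \<Rightarrow> quaternion \<times> quaternion. strip_map_formula n f \<longrightarrow>
      parameterized_hypercomplex_riemann_manifold TYPE(quaternion)
        (f ` slice_strip (pi * real n)) \<and>
      diffeomorphic (f ` slice_strip (pi * real n)) (slice_strip (pi * real n) :: quaternion set) \<and>
      slice_isothermal_parameterization (slice_strip (pi * real n)) f) \<and>
    (\<exists>f :: octonion \<Rightarrow> octonion \<times> octonion. strip_map_formula n f) \<and>
    (\<forall>f :: octonion \<Rightarrow> octonion \<times> octonion. strip_map_formula n f \<longrightarrow>
      parameterized_hypercomplex_riemann_manifold TYPE(octonion)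
        (f ` slice_strip (pi * real n)) \<and>
      diffeomorphic (f ` slice_strip (pi * real n)) (slice_strip (pi * real n) :: octonion set) \<and>
      slice_isothermal_parameterization (slice_strip (pi * real n)) f)"
proof -
  have n: "0 < n" using assms by simp
  show ?thesis
    by (intro conjI[OF exI[of _ "strip_map n"]] allI impI strip_map_formula_imp_isothermal_diffeomorphic[OF n]
        strip_map_formula_strip_map conjI exI[of _ "strip_map n"])
qed

end
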